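(* Let $r=r(u)$ be a smooth function and let $M\subset\mathbb{E}^4$ be the Aminov surface given by the Monge patch $X(u,v)=(u,v,r(u)\cos v,r(u)\sin v)$. Then $M$ is a non-trivial Chen surface.
   Context: Let $h$ be the second fundamental form of $M$ (with values in the normal bundle) and let $\overrightarrow H$ be the mean curvature vector, i.e. half the trace of $h$ with respect to the induced metric. For a normal field $N$, $A_N$ denotes the shape operator, $\langle A_NZ,Z'\rangle=\langle h(Z,Z'),N\rangle$ for tangent $Z,Z'$. If $\widetilde N_1,\widetilde N_2$ is an orthonormal normal frame with $\widetilde N_1$ parallel to $\overrightarrow H$, the allied mean curvature vector field is $a(\overrightarrow H)=\frac{\|\overrightarrow H\|}{2}\,\mathrm{tr}(A_{\widetilde N_1}A_{\widetilde N_2})\,\widetilde N_2$. $M$ is called a Chen surface (or $\mathcal A$-surface) if $a(\overrightarrow H)$ vanishes identically. The class of Chen surfaces contains all minimal surfaces ($\overrightarrow H\equiv0$), all pseudo-umbilical surfaces ($A_{\overrightarrow H}$ proportional to the identity), and all surfaces whose first normal space (the span of the values of $h$) has dimension at most $1$; these are called trivial Chen surfaces (trivial $\mathcal A$-surfaces), and a Chen surface that is not of these types is called non-trivial.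
   Formalization: M is shown to be Chen for every smooth r, but non-trivial exactly when r is not constant and |r''|(1+r²)=|r|(1+r'²) does not hold identically; the claim for all smooth r fails, e.g. r=0 gives a plane. *)

theory Defs
  imports "HOL-Analysis.Analysis"
begin

definition smooth_on_real :: "(real \<Rightarrow> real) \<Rightarrow> real set \<Rightarrow> bool" where
  "smooth_on_real f I \<longleftrightarrow> (\<forall>n. \<forall>t\<in>I. (deriv ^^ n) f differentiable (at t))"

text \<open>
  A surface in Euclidean 4-space is given by a patch \<open>X\<close> on an open set \<open>U\<close> of parameters, and
  assumed to be an immersion there (automatic for Monge patches).  A tangent
  vector at the point with parameter \<open>p\<close> is represented by its coordinate vector \<open>a\<close> in the parameter
  plane; the tangent vector itself is \<open>patch_deriv X p a\<close>.
\<close>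

definition patch_deriv :: "(real^2 \<Rightarrow> real^4) \<Rightarrow> real^2 \<Rightarrow> real^2 \<Rightarrow> real^4" where
  "patch_deriv X p a = frechet_derivative X (at p) a"

definition patch_deriv2 :: "(real^2 \<Rightarrow> real^4) \<Rightarrow> real^2 \<Rightarrow> real^2 \<Rightarrow> real^2 \<Rightarrow> real^4" where
  "patch_deriv2 X p a b = frechet_derivative (\<lambda>q. patch_deriv X q a) (at p) b"

definition tangent_plane :: "(real^2 \<Rightarrow> real^4) \<Rightarrow> real^2 \<Rightarrow> (real^4) set" where
  "tangent_plane X p = range (patch_deriv X p)"

definition normal_plane :: "(real^2 \<Rightarrow> real^4) \<Rightarrow> real^2 \<Rightarrow> (real^4) set" where
  "normal_plane X p = orthogonal_comp (tangent_plane X p)"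

definition normal_part :: "(real^2 \<Rightarrow> real^4) \<Rightarrow> real^2 \<Rightarrow> real^4 \<Rightarrow> real^4" where
  "normal_part X p w = (THE n. n \<in> normal_plane X p \<and> w - n \<in> tangent_plane X p)"

definition induced_metric :: "(real^2 \<Rightarrow> real^4) \<Rightarrow> real^2 \<Rightarrow> real^2 \<Rightarrow> real^2 \<Rightarrow> real" where
  "induced_metric X p a b = patch_deriv X p a \<bullet> patch_deriv X p b"

text \<open>
  By the Gauss formula, the second fundamental form is the normal part of the second derivative
  of the patch.
\<close>

definition second_fundamental_form ::
  "(real^2 \<Rightarrow> real^4) \<Rightarrow> real^2 \<Rightarrow> real^2 \<Rightarrow> real^2 \<Rightarrow> real^4" where
  "second_fundamental_form X p a b = normal_part X p (patch_deriv2 X p a b)"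

definition shape_operator ::
  "(real^2 \<Rightarrow> real^4) \<Rightarrow> real^2 \<Rightarrow> real^4 \<Rightarrow> real^2 \<Rightarrow> real^2" where
  "shape_operator X p N = (THE A. linear A \<and>
     (\<forall>a b. induced_metric X p (A a) b = second_fundamental_form X p a b \<bullet> N))"

definition gram_matrix :: "(real^2 \<Rightarrow> real^4) \<Rightarrow> real^2 \<Rightarrow> real^2^2" where
  "gram_matrix X p = (\<chi> i j. induced_metric X p (axis i 1) (axis j 1))"

text \<open>
  The trace of the bilinear form \<open>h\<close> with respect to the metric \<open>g\<close> is the contraction of the
  coefficients of \<open>h\<close> with the inverse of the matrix of \<open>g\<close>.
\<close>

definition mean_curvature_vector :: "(real^2 \<Rightarrow> real^4) \<Rightarrow> real^2 \<Rightarrow> real^4" where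
  "mean_curvature_vector X p = (1/2) *\<^sub>R
     (\<Sum>i\<in>UNIV. \<Sum>j\<in>UNIV. matrix_inv (gram_matrix X p) $ i $ j *\<^sub>R
        second_fundamental_form X p (axis i 1) (axis j 1))"

definition orthonormal_normal_frame ::
  "(real^2 \<Rightarrow> real^4) \<Rightarrow> real^2 \<Rightarrow> real^4 \<Rightarrow> real^4 \<Rightarrow> bool" where
  "orthonormal_normal_frame X p N1 N2 \<longleftrightarrow>
     N1 \<in> normal_plane X p \<and> N2 \<in> normal_plane X p \<and>
     norm N1 = 1 \<and> norm N2 = 1 \<and> orthogonal N1 N2"

text \<open>
  The allied mean curvature vector, computed in an orthonormal normal frame whose first member
  is parallel to the mean curvature vector.  Replacing a member of the frame by its negative
  changes nothing; where the mean curvature vector is zero, every frame is admissible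
  and the value is zero.
\<close>

definition allied_mean_curvature_vector ::
  "(real^2 \<Rightarrow> real^4) \<Rightarrow> real^2 \<Rightarrow> real^4 \<Rightarrow> real^4 \<Rightarrow> real^4" where
  "allied_mean_curvature_vector X p N1 N2 =
     (norm (mean_curvature_vector X p) / 2 *
      trace (matrix (shape_operator X p N1 \<circ> shape_operator X p N2))) *\<^sub>R N2"

definition chen_surface :: "(real^2 \<Rightarrow> real^4) \<Rightarrow> (real^2) set \<Rightarrow> bool" where
  "chen_surface X U \<longleftrightarrow>
     (\<forall>p\<in>U. \<forall>N1 N2. orthonormal_normal_frame X p N1 N2 \<longrightarrow>
        (\<exists>c. mean_curvature_vector X p = c *\<^sub>R N1) \<longrightarrow>
        allied_mean_curvature_vector X p N1 N2 = 0)"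

definition minimal_surface :: "(real^2 \<Rightarrow> real^4) \<Rightarrow> (real^2) set \<Rightarrow> bool" where
  "minimal_surface X U \<longleftrightarrow> (\<forall>p\<in>U. mean_curvature_vector X p = 0)"

definition pseudo_umbilical_surface :: "(real^2 \<Rightarrow> real^4) \<Rightarrow> (real^2) set \<Rightarrow> bool" where
  "pseudo_umbilical_surface X U \<longleftrightarrow>
     (\<forall>p\<in>U. \<exists>c. \<forall>a. shape_operator X p (mean_curvature_vector X p) a = c *\<^sub>R a)"

definition first_normal_space :: "(real^2 \<Rightarrow> real^4) \<Rightarrow> real^2 \<Rightarrow> (real^4) set" where
  "first_normal_space X p = span {second_fundamental_form X p a b | a b. True}"

definition trivial_chen_surface :: "(real^2 \<Rightarrow> real^4) \<Rightarrow> (real^2) set \<Rightarrow> bool" where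
  "trivial_chen_surface X U \<longleftrightarrow>
     minimal_surface X U \<or> pseudo_umbilical_surface X U \<or>
     (\<forall>p\<in>U. dim (first_normal_space X p) \<le> 1)"

definition nontrivial_chen_surface :: "(real^2 \<Rightarrow> real^4) \<Rightarrow> (real^2) set \<Rightarrow> bool" where
  "nontrivial_chen_surface X U \<longleftrightarrow> chen_surface X U \<and> \<not> trivial_chen_surface X U"

definition aminov_patch :: "(real \<Rightarrow> real) \<Rightarrow> real^2 \<Rightarrow> real^4" where
  "aminov_patch r p =
     vector [p$1, p$2, r (p$1) * cos (p$2), r (p$1) * sin (p$2)]"

text \<open>
  For an Aminov patch, \<open>|r''| (1 + r\<^sup>2) = |r| (1 + (r')\<^sup>2)\<close> says that at the given point either the
  mean curvature vector is zero (equality without the absolute values) or the shape operator in its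
  direction is a multiple of the identity (equality up to the sign), and for constant \<open>r\<close> the first
  normal spaces have dimension at most 1.  A generic radius function is one for which neither
  happens identically.
\<close>

definition generic_radius :: "(real \<Rightarrow> real) \<Rightarrow> real set \<Rightarrow> bool" where
  "generic_radius r I \<longleftrightarrow>
     \<not> r constant_on I \<and>
     (\<exists>t\<in>I. \<bar>deriv (deriv r) t\<bar> * (1 + (r t)\<^sup>2) \<noteq> \<bar>r t\<bar> * (1 + (deriv r t)\<^sup>2))"

end

theory Submission
  imports Defs
begin

text \<open>
  With \<open>e\<close> and \<open>f\<close> the radial and angular unit vectors of the last two coordinates, the normal plane
  of the Aminov surface has the orthogonal basis \<open>m = e - r' e\<^sub>1\<close>, \<open>n = f - r e\<^sub>2\<close>.  The shape
  operator of \<open>m\<close> is diagonal in the coordinate basis, that of \<open>n\<close> is off-diagonal, and the mean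
  curvature vector is a multiple of \<open>m\<close>.  Hence the trace of the product vanishes.
\<close>

section \<open>Uniqueness of normal parts and of inverse matrices\<close>

text \<open>Two candidates differ by a vector that is both tangent and normal, hence orthogonal to
  itself. This turns the definite description in \<open>normal_part\<close> into a check of two
  memberships.\<close>

lemma normal_part_eqI:
  assumes "linear (patch_deriv X p)"
    and "n \<in> normal_plane X p" and "w - n \<in> tangent_plane X p"
  shows "normal_part X p w = n"
  unfolding normal_part_def
proof (rule the_equality)
  fix n' assume n': "n' \<in> normal_plane X p \<and> w - n' \<in> tangent_plane X p"
  have "(w - n) - (w - n') \<in> tangent_plane X p"
    using assms n' by (metis subspace_diff linear_subspace_image subspace_UNIV tangent_plane_def)
  moreover have "n' - n \<in> normal_plane X p"
    using assms n' by (simp add: normal_plane_def subspace_diff subspace_orthogonal_comp)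
  ultimately have "(n' - n) \<bullet> (n' - n) = 0"
    by (auto simp: normal_plane_def orthogonal_comp_def orthogonal_def)
  then show "n' = n" by simp
qed (use assms in auto)

lemma matrix_inv_eqI:
  fixes A :: "'a::semiring_1^'n^'m"
  assumes "A ** B = mat 1" and "B ** A = mat 1"
  shows "matrix_inv A = B"
  unfolding matrix_inv_def
  by (rule some_equality) (use assms in \<open>auto, metis matrix_mul_assoc matrix_mul_lid matrix_mul_rid\<close>)

section \<open>Curvature at a single point, as algebra in an orthonormal frame\<close>

text \<open>Only the values \<open>s\<close>, \<open>s'\<close>, \<open>s''\<close> of the radius
  function and its first two derivatives at the point enter the curvature, so analysis is confined
  to the verification of these assumptions.\<close>

locale aminov_point =
  fixes X :: "real^2 \<Rightarrow> real^4" and p :: "real^2" and e1 e2 e f :: "real^4" and s s' s'' :: real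
  assumes patch_deriv: "patch_deriv X p a = a$1 *\<^sub>R (e1 + s' *\<^sub>R e) + a$2 *\<^sub>R (e2 + s *\<^sub>R f)"
    and patch_deriv2: "patch_deriv2 X p a b =
      (a$1 * b$1 * s'' - a$2 * b$2 * s) *\<^sub>R e + ((a$1 * b$2 + a$2 * b$1) * s') *\<^sub>R f"
    and norms: "e1 \<bullet> e1 = 1" "e2 \<bullet> e2 = 1" "e \<bullet> e = 1" "f \<bullet> f = 1"
    and orths: "e1 \<bullet> e2 = 0" "e1 \<bullet> e = 0" "e1 \<bullet> f = 0" "e2 \<bullet> e = 0" "e2 \<bullet> f = 0" "e \<bullet> f = 0"
begin

lemmas inner_frame = norms orths
  orths(1)[unfolded inner_commute[of e1]] orths(2)[unfolded inner_commute[of e1]]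
  orths(3)[unfolded inner_commute[of e1]] orths(4)[unfolded inner_commute[of e2]]
  orths(5)[unfolded inner_commute[of e2]] orths(6)[unfolded inner_commute[of e]]

text \<open>\<open>E\<close> and \<open>G\<close> have a double role: they are the diagonal
  coefficients of the induced metric, whose mixed coefficient is zero, and the squared lengths of
  \<open>m\<close> and \<open>n\<close>.\<close>

definition "E = 1 + s'\<^sup>2"
definition "G = 1 + s\<^sup>2"
definition "m = e - s' *\<^sub>R e1"
definition "n = f - s *\<^sub>R e2"

lemma E_pos: "E > 0" and G_pos: "G > 0"
  by (simp_all add: E_def G_def add_pos_nonneg)

lemma inner_m_m: "m \<bullet> m = E" and inner_n_n: "n \<bullet> n = G" and inner_m_n: "m \<bullet> n = 0"
  by (simp_all add: m_def n_def E_def G_def inner_frame inner_diff_left inner_diff_right power2_eq_square)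

lemma linear_patch_deriv: "linear (patch_deriv X p)"
  by (rule linearI) (simp_all add: patch_deriv algebra_simps)

lemma normal_planeI: "x *\<^sub>R m + y *\<^sub>R n \<in> normal_plane X p"
  by (auto simp: normal_plane_def tangent_plane_def orthogonal_comp_def orthogonal_def patch_deriv
      m_def n_def inner_add_left inner_add_right inner_diff_left inner_diff_right inner_frame)

text \<open>The vector \<open>e\<close> differs from \<open>m / E\<close> by a tangent vector and
  \<open>f\<close> differs from \<open>n / G\<close> by a tangent vector, so these quotients are
  their normal parts.\<close>

lemma second_fundamental_form:
  "second_fundamental_form X p a b =
    ((a$1 * b$1 * s'' - a$2 * b$2 * s) / E) *\<^sub>R m + ((a$1 * b$2 + a$2 * b$1) * s' / G) *\<^sub>R n"
  (is "_ = (?x / E) *\<^sub>R m + (?y / G) *\<^sub>R n")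
  unfolding second_fundamental_form_def
proof (rule normal_part_eqI[OF linear_patch_deriv normal_planeI])
  define x y where "x = ?x" and "y = ?y"
  \<comment> \<open>The tangent part is written with \<open>e\<close> still inside
    \<open>e1 + s' e\<close>, the first coordinate tangent vector, so that its coordinates can be
    read off below.\<close>
  have e: "e = (1 / E) *\<^sub>R (m + s' *\<^sub>R (e1 + s' *\<^sub>R e))"
  proof -
    have "m + s' *\<^sub>R (e1 + s' *\<^sub>R e) = E *\<^sub>R e"
      by (simp add: m_def E_def algebra_simps power2_eq_square)
    then show ?thesis using E_pos by simp
  qed
  have f: "f = (1 / G) *\<^sub>R (n + s *\<^sub>R (e2 + s *\<^sub>R f))"
  proof -
    have "n + s *\<^sub>R (e2 + s *\<^sub>R f) = G *\<^sub>R f"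
      by (simp add: n_def G_def algebra_simps power2_eq_square)
    then show ?thesis using G_pos by simp
  qed
  have "x *\<^sub>R e - (x / E) *\<^sub>R m = (x * s' / E) *\<^sub>R (e1 + s' *\<^sub>R e)"
    by (subst e) (simp add: scaleR_add_right)
  moreover have "y *\<^sub>R f - (y / G) *\<^sub>R n = (y * s / G) *\<^sub>R (e2 + s *\<^sub>R f)"
    by (subst f) (simp add: scaleR_add_right)
  ultimately have "x *\<^sub>R e + y *\<^sub>R f - ((x / E) *\<^sub>R m + (y / G) *\<^sub>R n) =
      patch_deriv X p (vector [x * s' / E, y * s / G])"
    unfolding patch_deriv by (simp add: algebra_simps)
  then show "patch_deriv2 X p a b - ((?x / E) *\<^sub>R m + (?y / G) *\<^sub>R n) \<in> tangent_plane X p"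
    unfolding patch_deriv2 tangent_plane_def x_def y_def by simp
qed

lemma induced_metric: "induced_metric X p a b = E * a$1 * b$1 + G * a$2 * b$2"
  by (simp add: induced_metric_def patch_deriv inner_add_left inner_add_right inner_frame
      E_def G_def algebra_simps power2_eq_square)

text \<open>The metric is diagonal, so the trace sees only the two diagonal values of the second
  fundamental form, and these have no \<open>n\<close> component.\<close>

lemma mean_curvature_vector: "mean_curvature_vector X p = ((s'' / E - s / G) / (2 * E)) *\<^sub>R m"
proof -
  define B :: "real^2^2" where "B = vector [vector [1 / E, 0], vector [0, 1 / G]]"
  have "gram_matrix X p ** B = mat 1" "B ** gram_matrix X p = mat 1"
    using E_pos G_pos
    by (auto simp: vec_eq_iff forall_2 matrix_matrix_mult_def sum_2 B_def gram_matrix_def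
        induced_metric mat_def axis_def)
  then have "matrix_inv (gram_matrix X p) = B"
    by (rule matrix_inv_eqI)
  then have "mean_curvature_vector X p =
      (1/2) *\<^sub>R ((1 / E) *\<^sub>R (s'' / E) *\<^sub>R m + (1 / G) *\<^sub>R (- s / E) *\<^sub>R m)"
    by (simp add: mean_curvature_vector_def sum_2 B_def second_fundamental_form axis_def)
  also have "\<dots> = ((1/2) * (1 / E * (s'' / E) + 1 / G * (- s / E))) *\<^sub>R m"
    by (simp only: scaleR_add_left flip: scaleR_scaleR)
  also have "(1/2) * (1 / E * (s'' / E) + 1 / G * (- s / E)) = (s'' / E - s / G) / (2 * E)"
    using E_pos G_pos by (simp add: field_simps)
  finally show ?thesis .
qed

text \<open>The matrix of the second fundamental form paired with \<open>N\<close>, its rows divided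
  by \<open>E\<close> and \<open>G\<close>: an index raised with the diagonal metric.\<close>

definition shape :: "real^4 \<Rightarrow> real^2 \<Rightarrow> real^2" where
  "shape N a = vector
    [(a$1 * s'' * (m \<bullet> N) / E + a$2 * s' * (n \<bullet> N) / G) / E,
     (a$1 * s' * (n \<bullet> N) / G - a$2 * s * (m \<bullet> N) / E) / G]"

lemma shape_operator: "shape_operator X p N = shape N"
  unfolding shape_operator_def
proof (rule the_equality)
  have "linear (shape N)"
    by (rule linearI) (auto simp: shape_def vec_eq_iff forall_2 add_divide_distrib diff_divide_distrib algebra_simps)
  moreover have "induced_metric X p (shape N a) b = second_fundamental_form X p a b \<bullet> N" for a b
    using E_pos G_pos
    by (simp add: induced_metric second_fundamental_form shape_def inner_add_left field_simps)
  ultimately show "linear (shape N) \<and>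
     (\<forall>a b. induced_metric X p (shape N a) b = second_fundamental_form X p a b \<bullet> N)" by blast
  fix A assume A: "linear A \<and>
     (\<forall>a b. induced_metric X p (A a) b = second_fundamental_form X p a b \<bullet> N)"
  show "A = shape N"
  proof
    fix a
    have "induced_metric X p (A a) b = induced_metric X p (shape N a) b" for b
      using A \<open>\<And>b a. induced_metric X p (shape N a) b = _\<close> by simp
    \<comment> \<open>Pairing with the coordinate vectors gives the components multiplied by
      \<open>E\<close> and \<open>G\<close>, which are positive and cancel.\<close>
    from this[of "axis 1 1"] this[of "axis 2 1"] show "A a = shape N a"
      using E_pos G_pos by (simp add: induced_metric axis_def vec_eq_iff forall_2)
  qed
qed

text \<open>If the mean curvature vector is zero, the norm factor is zero. Otherwise
  \<open>N1\<close> is a multiple of \<open>m\<close>, and \<open>N2\<close> is orthogonal to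
  \<open>m\<close>.\<close>

lemma allied_mean_curvature_vector:
  assumes "orthonormal_normal_frame X p N1 N2" and "mean_curvature_vector X p = c *\<^sub>R N1"
  shows "allied_mean_curvature_vector X p N1 N2 = 0"
proof (cases "mean_curvature_vector X p = 0")
  case False
  define k where "k = (s'' / E - s / G) / (2 * E)"
  have km: "c *\<^sub>R N1 = k *\<^sub>R m" using assms(2) mean_curvature_vector k_def by simp
  have "c \<noteq> 0" "k \<noteq> 0" using False km assms(2) by auto
  \<comment> \<open>Both scalars are nonzero, so orthogonality passes between \<open>N1\<close> and
    \<open>m\<close>. It makes \<open>shape N1\<close> diagonal and \<open>shape N2\<close>
    off-diagonal, and their composite has zero diagonal.\<close>
  have "c * (N1 \<bullet> n) = k * (m \<bullet> n)" "c * (N1 \<bullet> N2) = k * (m \<bullet> N2)"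
    using km by (metis inner_scaleR_left)+
  moreover have "N1 \<bullet> N2 = 0"
    using assms(1) by (simp add: orthonormal_normal_frame_def orthogonal_def)
  ultimately have "n \<bullet> N1 = 0" "m \<bullet> N2 = 0"
    using \<open>c \<noteq> 0\<close> \<open>k \<noteq> 0\<close> inner_m_n by (auto simp: inner_commute)
  then have "trace (matrix (shape N1 \<circ> shape N2)) = 0"
    by (simp add: trace_def matrix_def sum_2 shape_def axis_def)
  then show ?thesis by (simp add: allied_mean_curvature_vector_def shape_operator)
qed (simp add: allied_mean_curvature_vector_def)

text \<open>The shape operator of \<open>k m\<close> is diagonal with entries
  \<open>k s'' / E\<close> and \<open>- k s / G\<close>. They agree iff \<open>k = 0\<close>, that
  is \<open>s'' G = s E\<close>, or \<open>s'' G = - s E\<close>; the absolute values merge both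
  signs.\<close>

lemma pseudo_umbilical_iff:
  "(\<exists>c. \<forall>a. shape_operator X p (mean_curvature_vector X p) a = c *\<^sub>R a) \<longleftrightarrow>
    \<bar>s''\<bar> * (1 + s\<^sup>2) = \<bar>s\<bar> * (1 + s'\<^sup>2)"
proof -
  define k where "k = (s'' / E - s / G) / (2 * E)"
  have shape: "shape (k *\<^sub>R m) a = vector [k * s'' / E * a$1, - k * s / G * a$2]" for a
    using E_pos G_pos by (simp add: shape_def inner_m_m inner_m_n inner_commute[of n] mult_ac)
  have "(\<exists>c. \<forall>a. shape (k *\<^sub>R m) a = c *\<^sub>R a) \<longleftrightarrow> k * s'' / E = - k * s / G" (is "?l \<longleftrightarrow> ?r")
  proof
    assume ?l
    then obtain c where c: "shape (k *\<^sub>R m) a = c *\<^sub>R a" for a by blast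
    from c[of "axis 1 1"] c[of "axis 2 1"] show ?r
      by (auto simp: shape axis_def vec_eq_iff forall_2)
  next
    assume r: ?r
    have "shape (k *\<^sub>R m) a = (k * s'' / E) *\<^sub>R a" for a
      unfolding shape r[symmetric] by (simp add: vec_eq_iff forall_2)
    then show ?l by blast
  qed
  also have "\<dots> \<longleftrightarrow> k * (s'' * G + s * E) = 0"
    using E_pos G_pos by (simp add: field_simps) argo
  also have "\<dots> \<longleftrightarrow> (s'' * G = s * E \<or> s'' * G = - (s * E))"
  proof -
    have "k = 0 \<longleftrightarrow> s'' * G = s * E"
      using E_pos G_pos by (simp add: k_def field_simps)
    then show ?thesis by (simp add: eq_neg_iff_add_eq_0)
  qed
  also have "\<dots> \<longleftrightarrow> \<bar>s''\<bar> * G = \<bar>s\<bar> * E"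
    using E_pos G_pos by (metis abs_eq_iff abs_mult abs_of_pos)
  finally show ?thesis
    unfolding shape_operator mean_curvature_vector k_def E_def G_def .
qed

text \<open>A zero mean curvature vector has zero shape operator, a multiple of the identity, so the
  preceding equivalence applies.\<close>

lemma minimal_imp_abs_eq:
  assumes "mean_curvature_vector X p = 0"
  shows "\<bar>s''\<bar> * (1 + s\<^sup>2) = \<bar>s\<bar> * (1 + s'\<^sup>2)"
proof -
  have "shape 0 a = 0 *\<^sub>R a" for a by (simp add: shape_def vec_eq_iff forall_2)
  then show ?thesis using pseudo_umbilical_iff assms shape_operator by metis
qed

text \<open>The \<open>n\<close> components vanish identically iff \<open>s' = 0\<close>, and the
  \<open>m\<close> components iff \<open>s = s'' = 0\<close>. If neither happens, multiples of both
  \<open>m\<close> and \<open>n\<close> occur as values on coordinate vectors.\<close>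

lemma dim_first_normal_space_le_1_iff:
  "dim (first_normal_space X p) \<le> 1 \<longleftrightarrow> s' = 0 \<or> s = 0 \<and> s'' = 0"
proof -
  let ?S = "{second_fundamental_form X p a b | a b. True}"
  have dim: "dim (first_normal_space X p) = dim ?S" by (simp add: first_normal_space_def)
  have line: "dim ?S \<le> 1" if "?S \<subseteq> span {v}" for v
    using dim_le_card[OF that] by simp
  show ?thesis
  proof (cases "s' = 0 \<or> s = 0 \<and> s'' = 0")
    case True
    then have "?S \<subseteq> span {m} \<or> ?S \<subseteq> span {n}"
      by (auto simp: second_fundamental_form span_singleton)
    with True line dim show ?thesis by auto
  next
    case False
    then obtain x where "x \<noteq> 0" and x: "x *\<^sub>R m \<in> ?S"
    proof (cases "s = 0")
      case True
      with False have "s'' / E \<noteq> 0" using E_pos by auto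
      moreover have "(s'' / E) *\<^sub>R m = second_fundamental_form X p (axis 1 1) (axis 1 1)"
        by (simp add: second_fundamental_form axis_def)
      ultimately show ?thesis using that by blast
    next
      case False
      then have "- s / E \<noteq> 0" using E_pos by auto
      moreover have "(- s / E) *\<^sub>R m = second_fundamental_form X p (axis 2 1) (axis 2 1)"
        by (simp add: second_fundamental_form axis_def)
      ultimately show ?thesis using that by blast
    qed
    define y where "y = s' / G"
    have "y \<noteq> 0" using False G_pos by (simp add: y_def)
    have "y *\<^sub>R n = second_fundamental_form X p (axis 1 1) (axis 2 1)"
      by (simp add: second_fundamental_form axis_def y_def)
    then have y: "y *\<^sub>R n \<in> ?S" by blast
    have nz: "x *\<^sub>R m \<noteq> 0" "y *\<^sub>R n \<noteq> 0"
      using \<open>x \<noteq> 0\<close> \<open>y \<noteq> 0\<close> inner_m_m inner_n_n E_pos G_pos by auto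
    have orth: "(x *\<^sub>R m) \<bullet> (y *\<^sub>R n) = 0" by (simp add: inner_m_n)
    then have neq: "x *\<^sub>R m \<noteq> y *\<^sub>R n" using nz by (metis inner_eq_zero_iff)
    have "independent {x *\<^sub>R m, y *\<^sub>R n}"
      using nz orth
      by (intro pairwise_orthogonal_independent)
        (auto simp: pairwise_def orthogonal_def inner_commute)
    then have "card {x *\<^sub>R m, y *\<^sub>R n} \<le> dim ?S"
      using x y by (intro independent_card_le_dim) auto
    with neq dim False show ?thesis by simp
  qed
qed

end

section \<open>First and second derivatives of the Aminov patch\<close>

lemma has_derivative_vec_nth:
  "((\<lambda>x::real^'n. x$i) has_derivative (\<lambda>x. x$i)) (at p)"
  by (rule bounded_linear_imp_has_derivative[OF bounded_linear_vec_nth])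

definition radial :: "real \<Rightarrow> real^4" where
  "radial v = cos v *\<^sub>R axis 3 1 + sin v *\<^sub>R axis 4 1"

definition angular :: "real \<Rightarrow> real^4" where
  "angular v = - sin v *\<^sub>R axis 3 1 + cos v *\<^sub>R axis 4 1"

lemma aminov_patch_eq:
  "aminov_patch r = (\<lambda>p. p$1 *\<^sub>R axis 1 1 + p$2 *\<^sub>R axis 2 1 + r (p$1) *\<^sub>R radial (p$2))"
  by (rule ext) (simp add: aminov_patch_def vector_def radial_def vec_eq_iff forall_4 axis_def)

lemma has_derivative_radial:
  "((\<lambda>q. radial (q$2)) has_derivative (\<lambda>b. b$2 *\<^sub>R angular (p$2))) (at p)"
  unfolding radial_def angular_def
  by (auto intro!: derivative_eq_intros has_derivative_vec_nth simp: algebra_simps)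

lemma has_derivative_angular:
  "((\<lambda>q. angular (q$2)) has_derivative (\<lambda>b. - b$2 *\<^sub>R radial (p$2))) (at p)"
  unfolding radial_def angular_def
  by (auto intro!: derivative_eq_intros has_derivative_vec_nth simp: algebra_simps)

lemma has_derivative_comp_fst_component:
  assumes "(g has_real_derivative g') (at (p$1))"
  shows "((\<lambda>q::real^2. g (q$1)) has_derivative (\<lambda>b. b$1 * g')) (at p)"
  using has_derivative_compose[OF has_derivative_vec_nth
      assms[unfolded has_field_derivative_def]]
  by (simp add: mult.commute)

lemma patch_deriv_aminov:
  assumes "(r has_real_derivative r') (at (p$1))"
  shows "patch_deriv (aminov_patch r) p a =
    a$1 *\<^sub>R (axis 1 1 + r' *\<^sub>R radial (p$2)) + a$2 *\<^sub>R (axis 2 1 + r (p$1) *\<^sub>R angular (p$2))"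
proof -
  have "(aminov_patch r has_derivative (\<lambda>a. a$1 *\<^sub>R (axis 1 1 + r' *\<^sub>R radial (p$2)) +
      a$2 *\<^sub>R (axis 2 1 + r (p$1) *\<^sub>R angular (p$2)))) (at p)"
    unfolding aminov_patch_eq
    by (auto intro!: derivative_eq_intros has_derivative_vec_nth has_derivative_comp_fst_component[OF assms]
        has_derivative_radial simp: algebra_simps)
  then show ?thesis
    unfolding patch_deriv_def by (simp add: frechet_derivative_at[symmetric])
qed

text \<open>Differentiating once more requires the formula for the first derivative near
  \<open>p\<close>, not just at \<open>p\<close>; hence the open set \<open>I\<close>.\<close>

lemma patch_deriv2_aminov:
  assumes "open I" and "p$1 \<in> I"
    and r': "\<And>t. t \<in> I \<Longrightarrow> (r has_real_derivative r' t) (at t)"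
    and r'': "(r' has_real_derivative r'') (at (p$1))"
  shows "patch_deriv2 (aminov_patch r) p a b =
    (a$1 * b$1 * r'' - a$2 * b$2 * r (p$1)) *\<^sub>R radial (p$2) +
    ((a$1 * b$2 + a$2 * b$1) * r' (p$1)) *\<^sub>R angular (p$2)"
proof -
  let ?D = "\<lambda>q. a$1 *\<^sub>R (axis 1 1 + r' (q$1) *\<^sub>R radial (q$2)) +
    a$2 *\<^sub>R (axis 2 1 + r (q$1) *\<^sub>R angular (q$2))"
  have "(?D has_derivative (\<lambda>b. (a$1 * b$1 * r'' - a$2 * b$2 * r (p$1)) *\<^sub>R radial (p$2) +
    ((a$1 * b$2 + a$2 * b$1) * r' (p$1)) *\<^sub>R angular (p$2))) (at p)"
    by (auto intro!: derivative_eq_intros has_derivative_vec_nth has_derivative_comp_fst_component[OF r'']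
        has_derivative_comp_fst_component[OF r'[OF assms(2)]]
        has_derivative_radial has_derivative_angular simp: algebra_simps)
  then have "((\<lambda>q. patch_deriv (aminov_patch r) q a) has_derivative
    (\<lambda>b. (a$1 * b$1 * r'' - a$2 * b$2 * r (p$1)) *\<^sub>R radial (p$2) +
      ((a$1 * b$2 + a$2 * b$1) * r' (p$1)) *\<^sub>R angular (p$2))) (at p)"
  \<comment> \<open>\<open>?D\<close> equals the first derivative of the patch on the open strip
    over \<open>I\<close>, so its derivative at \<open>p\<close> carries over.\<close>
  proof (rule has_derivative_transform_within_open)
    show "open {q::real^2. q$1 \<in> I}"
      using continuous_open_preimage[of UNIV "\<lambda>q::real^2. q$1" I] \<open>open I\<close>
      by (simp add: continuous_on_component vimage_def)
    show "?D q = patch_deriv (aminov_patch r) q a" if "q \<in> {q. q$1 \<in> I}" for q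
      using patch_deriv_aminov[OF r'[of "q$1"], of a] that by simp
  qed (use assms(2) in simp)
  then show ?thesis
    unfolding patch_deriv2_def by (simp add: frechet_derivative_at[symmetric])
qed

lemma smooth_on_real_has_derivs:
  assumes "smooth_on_real r I" and "t \<in> I"
  shows "(r has_real_derivative deriv r t) (at t)"
    and "(deriv r has_real_derivative deriv (deriv r) t) (at t)"
proof -
  have "(deriv ^^ 0) r differentiable at t" "(deriv ^^ 1) r differentiable at t"
    using assms unfolding smooth_on_real_def by blast+
  then show "(r has_real_derivative deriv r t) (at t)"
    and "(deriv r has_real_derivative deriv (deriv r) t) (at t)"
    by (simp_all add: DERIV_deriv_iff_real_differentiable)
qed

text \<open>Makes the pointwise results available at every parameter point over
  \<open>I\<close>.\<close>

lemma aminov_point_aminov_patch: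
  assumes "open I" and "smooth_on_real r I" and "p$1 \<in> I"
  shows "aminov_point (aminov_patch r) p (axis 1 1) (axis 2 1) (radial (p$2)) (angular (p$2))
    (r (p$1)) (deriv r (p$1)) (deriv (deriv r) (p$1))"
proof
  note d = smooth_on_real_has_derivs[OF assms(2)]
  show "patch_deriv (aminov_patch r) p a = a$1 *\<^sub>R (axis 1 1 + deriv r (p$1) *\<^sub>R radial (p$2)) +
    a$2 *\<^sub>R (axis 2 1 + r (p$1) *\<^sub>R angular (p$2))" for a
    by (rule patch_deriv_aminov[OF d(1)[OF assms(3)]])
  show "patch_deriv2 (aminov_patch r) p a b =
    (a$1 * b$1 * deriv (deriv r) (p$1) - a$2 * b$2 * r (p$1)) *\<^sub>R radial (p$2) +
    ((a$1 * b$2 + a$2 * b$1) * deriv r (p$1)) *\<^sub>R angular (p$2)" for a b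
    by (rule patch_deriv2_aminov[OF assms(1,3) d(1) d(2)[OF assms(3)]])
qed (simp_all add: radial_def angular_def inner_vec_def sum_4 axis_def flip: power2_eq_square)

section \<open>Constancy of a function on an interval\<close>

lemma constant_on_imp_deriv_eq_0:
  fixes g :: "real \<Rightarrow> real"
  assumes "g constant_on I" and "open I" and "t \<in> I"
  shows "deriv g t = 0"
proof -
  obtain c where c: "\<And>x. x \<in> I \<Longrightarrow> g x = c" using assms(1) by (auto simp: constant_on_def)
  have "(g has_real_derivative 0) (at t)"
    using c by (intro has_field_derivative_transform_within_open[OF DERIV_const[of c] assms(2,3)]) simp
  then show ?thesis by (rule DERIV_imp_deriv)
qed

text \<open>Where \<open>g' = 0\<close> or \<open>g = 0\<close> at each point, the derivative of \<open>g\<^sup>2\<close> vanishes; if the constant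
  \<open>g\<^sup>2\<close> is not zero, then \<open>g\<close> has no zeros.\<close>

lemma constant_on_if_deriv_or_zero:
  fixes g :: "real \<Rightarrow> real"
  assumes "is_interval I" and g': "\<And>t. t \<in> I \<Longrightarrow> (g has_real_derivative g' t) (at t)"
    and zero: "\<And>t. t \<in> I \<Longrightarrow> g' t = 0 \<or> g t = 0"
  shows "g constant_on I"
proof -
  have const: "k constant_on I" if "\<And>t. t \<in> I \<Longrightarrow> (k has_real_derivative 0) (at t)"
    for k :: "real \<Rightarrow> real"
    using has_field_derivative_zero_constant[of I k] is_interval_convex[OF assms(1)] that
    by (auto simp: constant_on_def intro: DERIV_subset)
  have "(\<lambda>t. (g t)\<^sup>2) constant_on I"
    using zero by (intro const) (auto intro!: derivative_eq_intros g')
  then obtain c where c: "\<And>t. t \<in> I \<Longrightarrow> (g t)\<^sup>2 = c" by (auto simp: constant_on_def)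
  show ?thesis
  proof (cases "c = 0")
    case True
    with c show ?thesis by (auto simp: constant_on_def)
  next
    case False
    with c zero have "g' t = 0" if "t \<in> I" for t using that by force
    with g' show ?thesis by (intro const) metis
  qed
qed

section \<open>From pointwise conditions to the whole surface\<close>

text \<open>Non-triviality cannot hold for every smooth \<open>r\<close>: a constant one has first
  normal spaces of dimension at most 1. It is therefore characterised by an equivalence, while the
  Chen property is asserted outright.\<close>

theorem theorem5p2:
  fixes r :: "real \<Rightarrow> real" and I J :: "real set"
  assumes "open I" and "is_interval I" and "I \<noteq> {}"
    and "open J" and "is_interval J" and "J \<noteq> {}"
    and "smooth_on_real r I"
  shows "chen_surface (aminov_patch r) {p. p$1 \<in> I \<and> p$2 \<in> J} \<and>
    (nontrivial_chen_surface (aminov_patch r) {p. p$1 \<in> I \<and> p$2 \<in> J} \<longleftrightarrow> generic_radius r I)"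
proof -
  let ?X = "aminov_patch r" and ?U = "{p::real^2. p$1 \<in> I \<and> p$2 \<in> J}"
  let ?P = "\<lambda>t. \<bar>deriv (deriv r) t\<bar> * (1 + (r t)\<^sup>2) = \<bar>r t\<bar> * (1 + (deriv r t)\<^sup>2)"
  note pt = aminov_point_aminov_patch[OF assms(1,7)]
  note d = smooth_on_real_has_derivs[OF assms(7)]
  obtain v where "v \<in> J" using assms(6) by blast
  \<comment> \<open>The conditions depend on the first parameter alone; \<open>v\<close> completes
    any \<open>t\<close> in \<open>I\<close> to a point of \<open>?U\<close>.\<close>
  then have U: "(\<forall>p\<in>?U. Q (p$1)) \<longleftrightarrow> (\<forall>t\<in>I. Q t)" for Q
    by auto (metis vector_2)
  have chen: "chen_surface ?X ?U"
    unfolding chen_surface_def using aminov_point.allied_mean_curvature_vector[OF pt] by blast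
  have umbilical: "pseudo_umbilical_surface ?X ?U \<longleftrightarrow> (\<forall>t\<in>I. ?P t)"
    unfolding pseudo_umbilical_surface_def
    using aminov_point.pseudo_umbilical_iff[OF pt] U[of ?P] by simp
  \<comment> \<open>Minimality leads to the same equation \<open>?P\<close>, so "minimal or
    pseudo-umbilical" amounts to \<open>?P\<close> on all of \<open>I\<close>.\<close>
  have minimal: "minimal_surface ?X ?U \<Longrightarrow> \<forall>t\<in>I. ?P t"
    unfolding minimal_surface_def
    using aminov_point.minimal_imp_abs_eq[OF pt] U[of ?P] by simp
  have "(\<forall>p\<in>?U. dim (first_normal_space ?X p) \<le> 1) \<longleftrightarrow>
      (\<forall>t\<in>I. deriv r t = 0 \<or> r t = 0 \<and> deriv (deriv r) t = 0)"
    using aminov_point.dim_first_normal_space_le_1_iff[OF pt]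
      U[of "\<lambda>t. deriv r t = 0 \<or> r t = 0 \<and> deriv (deriv r) t = 0"] by simp
  \<comment> \<open>From left to right, each point has \<open>deriv r t = 0\<close> or
    \<open>r t = 0\<close>, which on an interval already forces constancy.\<close>
  also have "\<dots> \<longleftrightarrow> r constant_on I"
    using constant_on_imp_deriv_eq_0[OF _ assms(1)] constant_on_if_deriv_or_zero[OF assms(2) d(1)]
    by blast
  finally show ?thesis
    using chen umbilical minimal
    unfolding nontrivial_chen_surface_def trivial_chen_surface_def generic_radius_def by blast
qed

end
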